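(* Let $X_t$ be a BES($3$) process (three-dimensional Bessel process) starting from one. For any real $K\in[0,1/2]$, the function $t\mapsto E\{(1/X_t-K)^+\}$ is strictly decreasing for all $t\in(0,\infty)$. However, if $K>1/2$, the function $t\mapsto E\{(1/X_t-K)^+\}$ is increasing in a neighborhood of zero but is strictly decreasing for all large enough $t$. In particular, it is strictly decreasing for $$t\ge\left(K\log\frac{2K+1}{2K-1}\right)^{-1}.$$
   Context: BES($3$) starting from $x_0\ge0$ is the strong solution of $dX_t=\frac{1}{X_t}dt+d\beta_t$, $X_0=x_0$, with $\beta$ a one-dimensional standard Brownian motion; equivalently, it has the law of the Euclidean norm of a three-dimensional Brownian motion started at a point of norm $x_0$. $(x)^+=\max(x,0)$. *)

theory Defs
  imports "HOL-Probability.Probability"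
begin

definition brownian_motion ::
    "'w measure \<Rightarrow> (real \<Rightarrow> 'w \<Rightarrow> real ^ 'n) \<Rightarrow> real ^ 'n \<Rightarrow> bool" where
  "brownian_motion M B p \<longleftrightarrow>
     prob_space M \<and>
     (\<forall>t\<ge>0. B t \<in> borel_measurable M) \<and>
     (AE \<omega> in M. B 0 \<omega> = p) \<and>
     (\<forall>t :: nat \<Rightarrow> real. \<forall>n. 0 \<le> t 0 \<and> mono t \<longrightarrow>
        prob_space.indep_vars M (\<lambda>_. borel)
          (\<lambda>i \<omega>. B (t (Suc i)) \<omega> - B (t i) \<omega>) {..<n}) \<and>
     (\<forall>s t. 0 \<le> s \<and> s < t \<longrightarrow>
        distributed M lborel (\<lambda>\<omega>. B t \<omega> - B s \<omega>)
          (\<lambda>x. ennreal (\<Prod>i\<in>UNIV. normal_density 0 (sqrt (t - s)) (x $ i)))) \<and>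
     (AE \<omega> in M. continuous_on {0..} (\<lambda>t. B t \<omega>))"

definition process_law ::
    "'w measure \<Rightarrow> (real \<Rightarrow> 'w \<Rightarrow> real) \<Rightarrow> (real \<Rightarrow> real) measure" where
  "process_law M X =
     distr M (Pi\<^sub>M {0..} (\<lambda>_. borel)) (\<lambda>\<omega>. restrict (\<lambda>t. X t \<omega>) {0..})"

(* A three-dimensional Bessel process started at x0: a continuous process with the law
   of the Euclidean norm of a three-dimensional Brownian motion started at a point p
   of norm x0. Fixing the sample points of N to be of type "real => real ^ 3" loses no
   generality: every Brownian motion has a copy, with the same law, on the continuous
   paths with the trace of the product sigma-algebra. *)
definition BES3 :: "'w measure \<Rightarrow> (real \<Rightarrow> 'w \<Rightarrow> real) \<Rightarrow> real \<Rightarrow> bool" where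
  "BES3 M X x0 \<longleftrightarrow>
     prob_space M \<and>
     (\<forall>t\<ge>0. X t \<in> borel_measurable M) \<and>
     (AE \<omega> in M. continuous_on {0..} (\<lambda>t. X t \<omega>)) \<and>
     (\<exists>(N :: (real \<Rightarrow> real ^ 3) measure) B (p :: real ^ 3).
        brownian_motion N B p \<and> norm p = x0 \<and>
        process_law M X = process_law N (\<lambda>t \<omega>. norm (B t \<omega>)))"

end

theory Submission
  imports Defs
begin

text \<open>
  Integrating a radial function against a Gaussian in space, in cylindrical coordinates around the
  axis through the starting point, shows that \<open>X t\<close> has density
  \<open>r * (g (r - 1) - g (r + 1))\<close> on \<open>r \<ge> 0\<close>, where \<open>g\<close> is the centred normal density of variance
  \<open>t\<close>. The factor \<open>r\<close> cancels the singularity of \<open>1 / r\<close>, so the expectation is elementary in terms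
  of the normal distribution function, and its time derivative is a positive multiple of
  \<open>K * exp (- u / (2 * K^2)) * sinh (u / K) - u\<close> with \<open>u = 1 / t\<close>. For \<open>K \<le> 1/2\<close> this is negative because
  \<open>sinh x < x * exp x\<close>. For \<open>K > 1/2\<close> it is positive for large \<open>u\<close>, and it is strictly concave with
  value and slope 0 at \<open>u = 0\<close>, hence negative, up to
  \<open>u = K * ln ((2 * K + 1) / (2 * K - 1))\<close>.
\<close>

section \<open>Radial integrals against a Gaussian in three dimensions\<close>

text \<open>Boxes determine \<open>lborel\<close>, the preimage of a box under \<open>T\<close> is
  its image under \<open>inv T\<close>, and orthogonal maps preserve Lebesgue measure. Used to
  rotate the starting point onto a coordinate axis.\<close>

lemma lborel_distr_orthogonal:
  fixes T :: "real ^ 'n::{finite,wellorder} \<Rightarrow> real ^ 'n::_"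
  assumes T: "orthogonal_transformation T"
  shows "distr lborel borel T = lborel"
proof (rule lborel_eqI[symmetric])
  have [measurable]: "T \<in> borel_measurable borel"
    by (intro borel_measurable_continuous_onI linear_continuous_on linear_linear[THEN iffD2]
        orthogonal_transformation_linear T)
  fix l u :: "real ^ 'n::{finite,wellorder}"
  have inv: "orthogonal_transformation (inv T)"
    by (rule orthogonal_transformation_inv[OF T])
  have vimage: "T -` box l u = inv T ` box l u"
    by (metis T bij_vimage_eq_inv_image orthogonal_transformation_bij)
  have box: "box l u \<in> lmeasurable" by simp
  note meas = measurable_orthogonal_image[OF inv box] measure_orthogonal_image[OF inv box]
  have "T -` box l u \<in> sets borel"
    using measurable_sets_borel[of T borel "box l u"] by simp
  then have "emeasure (distr lborel borel T) (box l u) = emeasure lebesgue (inv T ` box l u)"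
    by (simp add: emeasure_distr vimage)
  also have "\<dots> = emeasure lebesgue (box l u)"
    using meas box by (simp add: emeasure_eq_measure2 fmeasurableD2 fmeasurableD)
  finally show "emeasure (distr lborel borel T) (box l u) = ennreal (prod ((\<bullet>) (u - l)) Basis)"
    if "\<And>b. b \<in> Basis \<Longrightarrow> l \<bullet> b \<le> u \<bullet> b"
    using that by (simp add: emeasure_lborel_box)
qed simp

text \<open>By definition \<open>lborel\<close> is the image of a product measure indexed by the
  basis vectors; the factors are split off one at a time.\<close>

lemma nn_integral_lborel_vec3:
  fixes F :: "real ^ 3 \<Rightarrow> ennreal"
  assumes [measurable]: "F \<in> borel_measurable borel"
  shows "(\<integral>\<^sup>+v. F v \<partial>lborel) = (\<integral>\<^sup>+x. \<integral>\<^sup>+y. \<integral>\<^sup>+z. F (vector [x, y, z]) \<partial>lborel \<partial>lborel \<partial>lborel)"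
proof -
  define e :: "3 \<Rightarrow> real ^ 3" where "e = (\<lambda>i. axis i 1)"
  interpret product_sigma_finite "\<lambda>_::real^3. lborel::real measure" ..
  have Basis: "(Basis :: (real ^ 3) set) = {e 1, e 2, e 3}"
    by (auto simp: Basis_vec_def e_def UNIV_3)
  have e_eq: "e i = e j \<longleftrightarrow> i = j" for i j
    by (simp add: e_def axis_eq_axis)
  \<comment> \<open>As a linear combination of basis vectors, \<open>vector\<close> comes within
    reach of \<open>measurable\<close>.\<close>
  have vec: "x *\<^sub>R e 1 + (y *\<^sub>R e 2 + z *\<^sub>R e 3) = vector [x, y, z]" for x y z
    by (simp add: e_def vec_eq_iff forall_3 axis_def)
  have sum: "(\<Sum>b\<in>{e 1, e 2, e 3}. f b *\<^sub>R b) = vector [f (e 1), f (e 2), f (e 3)]" for f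
    by (simp add: e_eq flip: vec)
  have [measurable]: "(\<lambda>f. vector [f (e 1), f (e 2), f (e 3)] :: real ^ 3)
      \<in> borel_measurable (Pi\<^sub>M {e 1, e 2, e 3} (\<lambda>_. lborel))"
    unfolding vec[symmetric] by measurable
  have vec2 [measurable]: "(\<lambda>f. vector [x, f (e 2), f (e 3)] :: real ^ 3)
      \<in> borel_measurable (Pi\<^sub>M {e 2, e 3} (\<lambda>_. lborel))" for x
    unfolding vec[symmetric] by measurable
  have vec3 [measurable]: "(\<lambda>z. vector [x, y, z] :: real ^ 3) \<in> borel_measurable lborel" for x y
    unfolding vec[symmetric] by measurable
  have "(\<integral>\<^sup>+v. F v \<partial>lborel) =
      (\<integral>\<^sup>+f. F (vector [f (e 1), f (e 2), f (e 3)]) \<partial>Pi\<^sub>M {e 1, e 2, e 3} (\<lambda>_. lborel))"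
    by (subst lborel_def) (simp add: nn_integral_distr Basis sum flip: lborel_eq_real)
  also have "\<dots> = (\<integral>\<^sup>+x. \<integral>\<^sup>+f. F (vector [x, f (e 2), f (e 3)]) \<partial>Pi\<^sub>M {e 2, e 3} (\<lambda>_. lborel) \<partial>lborel)"
    by (subst product_nn_integral_insert_rev) (auto simp: e_eq)
  also have "\<dots> = (\<integral>\<^sup>+x. \<integral>\<^sup>+y. \<integral>\<^sup>+f. F (vector [x, y, f (e 3)]) \<partial>Pi\<^sub>M {e 3} (\<lambda>_. lborel) \<partial>lborel \<partial>lborel)"
    by (intro nn_integral_cong, subst product_nn_integral_insert_rev) (auto simp: e_eq)
  also have "\<dots> = (\<integral>\<^sup>+x. \<integral>\<^sup>+y. \<integral>\<^sup>+z. F (vector [x, y, z]) \<partial>lborel \<partial>lborel \<partial>lborel)"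
    by (intro nn_integral_cong product_nn_integral_singleton) auto
  finally show ?thesis .
qed

text \<open>The substitution \<open>s = r^2\<close> is made on each \<open>[0, n]\<close>, and
  monotone convergence extends it to the half line.\<close>

lemma nn_integral_square_substitution:
  fixes k :: "real \<Rightarrow> ennreal"
  assumes [measurable]: "k \<in> borel_measurable borel"
  shows "(\<integral>\<^sup>+r. k (r\<^sup>2) * ennreal (2 * r) * indicator {0..} r \<partial>lborel)
       = (\<integral>\<^sup>+s. k s * indicator {0..} s \<partial>lborel)"
proof -
  have sup: "(SUP n. indicator {0..real n} x :: ennreal) = indicator {0..} x" for x
  proof -
    obtain n where "x \<le> real n" using real_arch_simple by blast
    then show ?thesis
      by (cases "x \<ge> 0") (auto intro!: antisym SUP_least SUP_upper2[of n] simp: indicator_def)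
  qed
  have sup2: "(SUP n. indicator {0..(real n)\<^sup>2} x :: ennreal) = indicator {0..} x" for x
  proof -
    obtain n where "x \<le> real n" using real_arch_simple by blast
    moreover have "real n \<le> (real n)\<^sup>2" by (cases n) (auto simp: power2_eq_square)
    ultimately have "x \<le> (real n)\<^sup>2" by linarith
    then show ?thesis
      by (cases "x \<ge> 0") (auto intro!: antisym SUP_least SUP_upper2[of n] simp: indicator_def)
  qed
  have "(\<integral>\<^sup>+r. k (r\<^sup>2) * ennreal (2 * r) * indicator {0..} r \<partial>lborel)
      = (\<integral>\<^sup>+r. (SUP n. k (r\<^sup>2) * ennreal (2 * r) * indicator {0..real n} r) \<partial>lborel)"
    by (simp add: sup SUP_mult_left_ennreal[symmetric])
  also have "\<dots> = (SUP n. \<integral>\<^sup>+r. k (r\<^sup>2) * ennreal (2 * r) * indicator {0..real n} r \<partial>lborel)"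
    by (rule nn_integral_monotone_convergence_SUP)
       (auto simp: incseq_def le_fun_def indicator_def)
  also have "\<dots> = (SUP n. \<integral>\<^sup>+s. k s * indicator {0..(real n)\<^sup>2} s \<partial>lborel)"
  proof (rule SUP_cong)
    fix n :: nat
    have "(\<integral>\<^sup>+s. k s * indicator {0\<^sup>2..(real n)\<^sup>2} s \<partial>lborel)
       = (\<integral>\<^sup>+r. k (r\<^sup>2) * ennreal (2 * r) * indicator {0..real n} r \<partial>lborel)"
    \<comment> \<open>The substitution rule is for nondegenerate intervals; for \<open>n = 0\<close>
      both sides are integrals over a null set.\<close>
    proof (cases "n = 0")
      case True
      then show ?thesis by (simp add: nn_integral_null_set)
    next
      case False
      then show ?thesis
        by (intro nn_integral_substitution_aux[where g = "\<lambda>r. r\<^sup>2" and g' = "\<lambda>r. 2 * r"])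
           (auto intro!: derivative_eq_intros continuous_intros)
    qed
    then show "(\<integral>\<^sup>+r. k (r\<^sup>2) * ennreal (2 * r) * indicator {0..real n} r \<partial>lborel)
      = (\<integral>\<^sup>+s. k s * indicator {0..(real n)\<^sup>2} s \<partial>lborel)" by simp
  qed simp
  also have "\<dots> = (\<integral>\<^sup>+s. (SUP n. k s * indicator {0..(real n)\<^sup>2} s) \<partial>lborel)"
  proof (rule nn_integral_monotone_convergence_SUP[symmetric])
    have "(real m)\<^sup>2 \<le> (real n)\<^sup>2" if "m \<le> n" for m n
      using that by (simp add: power_mono)
    then show "incseq (\<lambda>n s. k s * indicator {0..(real n)\<^sup>2} s)"
      unfolding incseq_def le_fun_def indicator_def using order_trans by fastforce
  qed auto
  also have "\<dots> = (\<integral>\<^sup>+s. k s * indicator {0..} s \<partial>lborel)"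
    by (simp add: sup2 SUP_mult_left_ennreal[symmetric])
  finally show ?thesis .
qed

lemma nn_integral_even:
  fixes k :: "real \<Rightarrow> ennreal"
  assumes [measurable]: "k \<in> borel_measurable borel" and even: "\<And>x. k (- x) = k x"
  shows "(\<integral>\<^sup>+x. k x \<partial>lborel) = 2 * (\<integral>\<^sup>+x. k x * indicator {0..} x \<partial>lborel)"
proof -
  \<comment> \<open>Both closed half lines contain 0, which is harmless because a point is a null
    set.\<close>
  have "(\<integral>\<^sup>+x. k x \<partial>lborel) = (\<integral>\<^sup>+x. k x * indicator {0..} x + k x * indicator {..0} x \<partial>lborel)"
    by (intro nn_integral_cong_AE AE_I[where N="{0}"]) (auto split: split_indicator split_indicator_asm)
  also have "\<dots> = (\<integral>\<^sup>+x. k x * indicator {0..} x \<partial>lborel) + (\<integral>\<^sup>+x. k x * indicator {..0} x \<partial>lborel)"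
    by (rule nn_integral_add) auto
  also have "(\<integral>\<^sup>+x. k x * indicator {..0} x \<partial>lborel) = (\<integral>\<^sup>+x. k x * indicator {0..} x \<partial>lborel)"
    by (subst nn_integral_real_affine[where t=0 and c="-1"])
       (auto simp: even intro!: nn_integral_cong split: split_indicator)
  finally show ?thesis by (simp flip: mult_2)
qed

text \<open>The antiderivative is \<open>arctan\<close>. This is the source of the factor
  \<open>pi\<close> in the plane integral.\<close>

lemma nn_integral_inverse_1_plus_square: "(\<integral>\<^sup>+s. ennreal (1 / (1 + (s::real)\<^sup>2)) \<partial>lborel) = ennreal pi"
proof -
  have "(\<integral>\<^sup>+s. ennreal (1 / (1 + (s::real)\<^sup>2)) * indicator {0..} s \<partial>lborel) = ennreal (pi / 2 - arctan 0)"
    by (rule nn_integral_FTC_atLeast)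
       (auto intro!: derivative_eq_intros tendsto_arctan_at_top simp: add_nonneg_eq_0_iff field_simps)
  then show ?thesis
    by (subst nn_integral_even) (auto simp: ennreal_mult'[symmetric] simp flip: ennreal_numeral)
qed

text \<open>The substitution \<open>z = y * s\<close> separates the variables, which avoids polar coordinates.\<close>

lemma nn_integral_plane_radial:
  fixes k :: "real \<Rightarrow> ennreal"
  assumes [measurable]: "k \<in> borel_measurable borel"
  shows "(\<integral>\<^sup>+y. \<integral>\<^sup>+z. k (y\<^sup>2 + z\<^sup>2) \<partial>lborel \<partial>lborel) = pi * (\<integral>\<^sup>+s. k s * indicator {0..} s \<partial>lborel)"
proof -
  \<comment> \<open>For a fixed slope \<open>s\<close>, put \<open>u = y^2\<close> and then rescale
    by \<open>1 + s^2\<close>.\<close>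
  have radial: "(\<integral>\<^sup>+y. \<bar>y\<bar> * k (y\<^sup>2 * (1 + s\<^sup>2)) \<partial>lborel)
      = ennreal (1 / (1 + s\<^sup>2)) * (\<integral>\<^sup>+u. k u * indicator {0..} u \<partial>lborel)" for s :: real
  proof -
    define q where "q = 1 / (1 + s\<^sup>2)"
    have q: "q > 0" by (simp add: q_def add_pos_nonneg)
    have pos: "1 + s\<^sup>2 > 0" by (simp add: add_pos_nonneg)
    have "(\<integral>\<^sup>+y. \<bar>y\<bar> * k (y\<^sup>2 * (1 + s\<^sup>2)) \<partial>lborel)
        = 2 * (\<integral>\<^sup>+y. \<bar>y\<bar> * k (y\<^sup>2 * (1 + s\<^sup>2)) * indicator {0..} y \<partial>lborel)"
      by (rule nn_integral_even) auto
    also have "\<dots> = (\<integral>\<^sup>+y. k (y\<^sup>2 * (1 + s\<^sup>2)) * ennreal (2 * y) * indicator {0..} y \<partial>lborel)"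
      by (subst nn_integral_cmult[symmetric])
         (auto intro!: nn_integral_cong split: split_indicator simp: ennreal_mult' mult_ac)
    also have "\<dots> = (\<integral>\<^sup>+u. k (u * (1 + s\<^sup>2)) * indicator {0..} u \<partial>lborel)"
      by (rule nn_integral_square_substitution) auto
    also have "\<dots> = ennreal q * (\<integral>\<^sup>+u. k u * indicator {0..} u \<partial>lborel)"
      using q pos
      by (subst nn_integral_real_affine[where t=0 and c=q])
         (auto simp: q_def zero_le_mult_iff zero_le_divide_iff intro!: arg_cong2[where f="(*)"] nn_integral_cong split: split_indicator)
    finally show ?thesis by (simp add: q_def)
  qed
  have "(\<integral>\<^sup>+y. \<integral>\<^sup>+z. k (y\<^sup>2 + z\<^sup>2) \<partial>lborel \<partial>lborel)
      = (\<integral>\<^sup>+y. \<integral>\<^sup>+s. \<bar>y\<bar> * k (y\<^sup>2 * (1 + s\<^sup>2)) \<partial>lborel \<partial>lborel)"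
  \<comment> \<open>The change of variable \<open>z = y * s\<close> degenerates at
    \<open>y = 0\<close> only.\<close>
  proof (intro nn_integral_cong_AE AE_I[where N="{0}"] subsetI)
    fix y assume "y \<in> {y \<in> space lborel. (\<integral>\<^sup>+z. k (y\<^sup>2 + z\<^sup>2) \<partial>lborel) \<noteq> (\<integral>\<^sup>+s. \<bar>y\<bar> * k (y\<^sup>2 * (1 + s\<^sup>2)) \<partial>lborel)}"
    then have *: "(\<integral>\<^sup>+z. k (y\<^sup>2 + z\<^sup>2) \<partial>lborel) \<noteq> (\<integral>\<^sup>+s. \<bar>y\<bar> * k (y\<^sup>2 * (1 + s\<^sup>2)) \<partial>lborel)" by simp
    have "y = 0"
    proof (rule ccontr)
      assume "y \<noteq> 0"
      then have "(\<integral>\<^sup>+z. k (y\<^sup>2 + z\<^sup>2) \<partial>lborel) = (\<integral>\<^sup>+s. \<bar>y\<bar> * k (y\<^sup>2 * (1 + s\<^sup>2)) \<partial>lborel)"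
        by (subst nn_integral_real_affine[where t=0 and c=y])
           (auto simp: nn_integral_cmult power_mult_distrib algebra_simps)
      with * show False by contradiction
    qed
    then show "y \<in> {0}" by simp
  qed auto
  also have "\<dots> = (\<integral>\<^sup>+s. \<integral>\<^sup>+y. \<bar>y\<bar> * k (y\<^sup>2 * (1 + s\<^sup>2)) \<partial>lborel \<partial>lborel)"
    by (rule lborel_pair.Fubini'[symmetric]) auto
  also have "\<dots> = pi * (\<integral>\<^sup>+u. k u * indicator {0..} u \<partial>lborel)"
    unfolding radial
    by (subst nn_integral_multc) (auto simp: nn_integral_inverse_1_plus_square)
  finally show ?thesis .
qed

lemma normal_density_sqrt:
  "t > 0 \<Longrightarrow> normal_density 0 (sqrt t) x = exp (- x\<^sup>2 / (2 * t)) / sqrt (2 * pi * t)"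
  by (simp add: normal_density_def)

text \<open>The exponents add up to the squared norm, which makes the Gaussian invariant under
  rotation.\<close>

lemma gaussian_product_3:
  assumes "t > 0"
  shows "(\<Prod>i\<in>UNIV. normal_density 0 (sqrt t) ((v :: real ^ 3) $ i))
       = exp (- (norm v)\<^sup>2 / (2 * t)) / sqrt (2 * pi * t) ^ 3"
proof -
  have "(norm v)\<^sup>2 = (\<Sum>i\<in>UNIV. (v $ i)\<^sup>2)"
    by (simp add: norm_vec_def L2_set_def sum_nonneg)
  then have "- (norm v)\<^sup>2 / (2 * t) = (\<Sum>i\<in>UNIV. - (v $ i)\<^sup>2 / (2 * t))"
    by (simp add: sum_divide_distrib sum_negf)
  then show ?thesis
    by (simp only: normal_density_sqrt[OF assms] prod_dividef exp_sum finite prod_constant)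
       simp
qed

text \<open>After a rotation \<open>p\<close> lies on the first axis. The plane orthogonal to it is
  integrated radially, and with the squared distance from the origin as variable the remaining
  integral along the axis is that of an exponential of a linear function.\<close>

lemma nn_integral_norm_gaussian_3:
  fixes p :: "real ^ 3" and h :: "real \<Rightarrow> ennreal"
  assumes [measurable]: "h \<in> borel_measurable borel" and t: "t > 0" and c: "norm p = c" "c > 0"
  defines "g \<equiv> normal_density 0 (sqrt t)"
  shows "(\<integral>\<^sup>+v. h (norm (p + v)) * ennreal (\<Prod>i\<in>UNIV. g (v $ i)) \<partial>lborel)
       = (\<integral>\<^sup>+r. h r * ennreal (r / c * (g (r - c) - g (r + c))) * indicator {0..} r \<partial>lborel)"
proof -
  define N where "N = (\<lambda>v :: real ^ 3. ennreal (\<Prod>i\<in>UNIV. g (v $ i)))"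
  define e :: "real ^ 3" where "e = vector [c, 0, 0]"
  have g_eq: "g x = exp (- x\<^sup>2 / (2 * t)) / sqrt (2 * pi * t)" for x
    using t by (simp add: g_def normal_density_sqrt)
  have N_eq: "N v = ennreal (exp (- (norm v)\<^sup>2 / (2 * t)) / sqrt (2 * pi * t) ^ 3)" for v
    by (simp add: N_def g_def gaussian_product_3 t)
  have [measurable]: "N \<in> borel_measurable borel"
    unfolding N_eq[abs_def] by measurable
  have "norm e = norm p"
    using c by (simp add: e_def norm_vec_def L2_set_def sum_3)
  then obtain T :: "real ^ 3 \<Rightarrow> real ^ 3" where T: "orthogonal_transformation T" "T e = p"
    using orthogonal_transformation_exists by blast
  have [measurable]: "T \<in> borel_measurable borel"
    by (intro borel_measurable_continuous_onI linear_continuous_on linear_linear[THEN iffD2]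
        orthogonal_transformation_linear T)
  have norm_T: "norm (T v) = norm v" for v
    using T orthogonal_transformation_norm by blast
  have "(\<integral>\<^sup>+v. h (norm (p + v)) * N v \<partial>lborel)
      = (\<integral>\<^sup>+v. h (norm (p + v)) * N v \<partial>distr lborel borel T)"
    using lborel_distr_orthogonal[OF T(1)] by simp
  also have "\<dots> = (\<integral>\<^sup>+v. h (norm (p + T v)) * N (T v) \<partial>lborel)"
    by (rule nn_integral_distr) auto
  \<comment> \<open>Since \<open>p = T e\<close>, linearity gives
    \<open>p + T v = T (e + v)\<close>, and \<open>T\<close> then disappears from both
    norms.\<close>
  also have "\<dots> = (\<integral>\<^sup>+v. h (norm (e + v)) * N v \<partial>lborel)"
    unfolding T(2)[symmetric] linear_add[OF orthogonal_transformation_linear[OF T(1)], symmetric]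
      norm_T N_eq ..
  also have "\<dots> = (\<integral>\<^sup>+x. \<integral>\<^sup>+y. \<integral>\<^sup>+z. h (norm (e + vector [x, y, z])) * N (vector [x, y, z]) \<partial>lborel \<partial>lborel \<partial>lborel)"
    by (rule nn_integral_lborel_vec3) auto
  also have "\<dots> = (\<integral>\<^sup>+x. \<integral>\<^sup>+y. \<integral>\<^sup>+z. h (sqrt ((c + x)\<^sup>2 + (y\<^sup>2 + z\<^sup>2)))
      * ennreal (g x * (exp (- (y\<^sup>2 + z\<^sup>2) / (2 * t)) / (2 * pi * t))) \<partial>lborel \<partial>lborel \<partial>lborel)"
  proof -
    have "norm (e + vector [x, y, z]) = sqrt ((c + x)\<^sup>2 + (y\<^sup>2 + z\<^sup>2))" for x y z
      by (simp add: e_def norm_vec_def L2_set_def sum_3 add.assoc)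
    moreover have "N (vector [x, y, z]) = ennreal (g x * (exp (- (y\<^sup>2 + z\<^sup>2) / (2 * t)) / (2 * pi * t)))" for x y z
    proof -
      have "exp (- y\<^sup>2 / (2 * t)) * exp (- z\<^sup>2 / (2 * t)) = exp (- (y\<^sup>2 + z\<^sup>2) / (2 * t))"
        unfolding mult_exp_exp by (simp only: add_divide_distrib[symmetric] minus_add_distrib)
      moreover have "sqrt (2 * pi * t) * sqrt (2 * pi * t) = 2 * pi * t"
        using t by (intro real_sqrt_mult_self[THEN trans]) simp
      ultimately have "g y * g z = exp (- (y\<^sup>2 + z\<^sup>2) / (2 * t)) / (2 * pi * t)"
        unfolding g_eq times_divide_times_eq by (simp only:)
      moreover have "(\<Prod>i\<in>UNIV. g ((vector [x, y, z] :: real ^ 3) $ i)) = g x * (g y * g z)"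
        unfolding UNIV_3 by simp
      ultimately show ?thesis
        unfolding N_def by (simp only:)
    qed
    ultimately show ?thesis by (simp only:)
  qed
  also have "\<dots> = (\<integral>\<^sup>+x. pi * (\<integral>\<^sup>+s. h (sqrt ((c + x)\<^sup>2 + s))
      * ennreal (g x * (exp (- s / (2 * t)) / (2 * pi * t))) * indicator {0..} s \<partial>lborel) \<partial>lborel)"
    by (intro nn_integral_cong nn_integral_plane_radial) (simp add: g_def)
  \<comment> \<open>Shifting \<open>s\<close> by \<open>(c + x)^2\<close> turns it into the squared
    distance from the origin; the terms in \<open>x^2\<close> cancel, so the exponent becomes linear
    in \<open>x\<close>.\<close>
  also have "\<dots> = (\<integral>\<^sup>+x. \<integral>\<^sup>+s. h (sqrt s)
      * (ennreal (exp ((c\<^sup>2 + 2 * c * x - s) / (2 * t)) / (2 * t * sqrt (2 * pi * t))) * indicator {(c + x)\<^sup>2..} s) \<partial>lborel \<partial>lborel)"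
  proof (intro nn_integral_cong)
    fix x :: real
    have *: "pi * (g x * (exp (- (s - (c + x)\<^sup>2) / (2 * t)) / (2 * pi * t)))
        = exp ((c\<^sup>2 + 2 * c * x - s) / (2 * t)) / (2 * t * sqrt (2 * pi * t))" for s
    proof -
      have "- x\<^sup>2 / (2 * t) + - (s - (c + x)\<^sup>2) / (2 * t) = (c\<^sup>2 + 2 * c * x - s) / (2 * t)"
        unfolding add_divide_distrib[symmetric]
        by (rule arg_cong[where f="\<lambda>u. u / (2 * t)"]) (simp add: power2_sum)
      then have "exp (- x\<^sup>2 / (2 * t)) * exp (- (s - (c + x)\<^sup>2) / (2 * t)) = exp ((c\<^sup>2 + 2 * c * x - s) / (2 * t))"
        by (metis exp_add)
      then show ?thesis using t by (simp add: g_eq field_simps)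
    qed
    have "pi * (\<integral>\<^sup>+s. h (sqrt ((c + x)\<^sup>2 + s))
        * ennreal (g x * (exp (- s / (2 * t)) / (2 * pi * t))) * indicator {0..} s \<partial>lborel)
      = pi * (\<integral>\<^sup>+s. h (sqrt s)
        * ennreal (g x * (exp (- (s - (c + x)\<^sup>2) / (2 * t)) / (2 * pi * t))) * indicator {0..} (s - (c + x)\<^sup>2) \<partial>lborel)"
      by (subst (2) nn_integral_real_affine[where t="(c + x)\<^sup>2" and c=1]) auto
    also have "\<dots> = (\<integral>\<^sup>+s. h (sqrt s) *
        (ennreal (pi * (g x * (exp (- (s - (c + x)\<^sup>2) / (2 * t)) / (2 * pi * t)))) * indicator {(c + x)\<^sup>2..} s) \<partial>lborel)"
    proof (subst nn_integral_cmult[symmetric])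
      have ind: "indicator {0..} (s - (c + x)\<^sup>2) = (indicator {(c + x)\<^sup>2..} s :: ennreal)" for s
        by (simp add: indicator_def)
      show "(\<integral>\<^sup>+s. pi * (h (sqrt s)
          * ennreal (g x * (exp (- (s - (c + x)\<^sup>2) / (2 * t)) / (2 * pi * t))) * indicator {0..} (s - (c + x)\<^sup>2)) \<partial>lborel)
        = (\<integral>\<^sup>+s. h (sqrt s) *
          (ennreal (pi * (g x * (exp (- (s - (c + x)\<^sup>2) / (2 * t)) / (2 * pi * t)))) * indicator {(c + x)\<^sup>2..} s) \<partial>lborel)"
        unfolding ennreal_mult'[OF pi_ge_zero] ind by (simp only: mult_ac)
    qed auto
    finally show "pi * (\<integral>\<^sup>+s. h (sqrt ((c + x)\<^sup>2 + s))
        * ennreal (g x * (exp (- s / (2 * t)) / (2 * pi * t))) * indicator {0..} s \<partial>lborel)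
      = (\<integral>\<^sup>+s. h (sqrt s)
      * (ennreal (exp ((c\<^sup>2 + 2 * c * x - s) / (2 * t)) / (2 * t * sqrt (2 * pi * t))) * indicator {(c + x)\<^sup>2..} s) \<partial>lborel)"
      unfolding * .
  qed
  also have "\<dots> = (\<integral>\<^sup>+s. \<integral>\<^sup>+x. h (sqrt s)
      * (ennreal (exp ((c\<^sup>2 + 2 * c * x - s) / (2 * t)) / (2 * t * sqrt (2 * pi * t))) * indicator {(c + x)\<^sup>2..} s) \<partial>lborel \<partial>lborel)"
    by (rule lborel_pair.Fubini'[symmetric]) (measurable, simp add: atLeast_def)
  also have "\<dots> = (\<integral>\<^sup>+s. h (sqrt s) * ennreal ((g (sqrt s - c) - g (sqrt s + c)) / (2 * c)) * indicator {0..} s \<partial>lborel)"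
  proof (intro nn_integral_cong)
    fix s :: real
    \<comment> \<open>An antiderivative in \<open>x\<close>: the inner derivative
      \<open>c / t\<close> trades the \<open>2 * t\<close> in the denominator for
      \<open>2 * c\<close>.\<close>
    let ?G = "\<lambda>x. exp ((c\<^sup>2 + 2 * c * x - s) / (2 * t)) / (2 * c * sqrt (2 * pi * t))"
    have "(\<integral>\<^sup>+x. h (sqrt s) * (ennreal (exp ((c\<^sup>2 + 2 * c * x - s) / (2 * t)) / (2 * t * sqrt (2 * pi * t)))
         * indicator {(c + x)\<^sup>2..} s) \<partial>lborel)
      = h (sqrt s) * (\<integral>\<^sup>+x. (ennreal (exp ((c\<^sup>2 + 2 * c * x - s) / (2 * t)) / (2 * t * sqrt (2 * pi * t)))
         * indicator {(c + x)\<^sup>2..} s) \<partial>lborel)"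
      by (rule nn_integral_cmult) (measurable, simp add: atLeast_def)
    also have "(\<integral>\<^sup>+x. (ennreal (exp ((c\<^sup>2 + 2 * c * x - s) / (2 * t)) / (2 * t * sqrt (2 * pi * t)))
         * indicator {(c + x)\<^sup>2..} s) \<partial>lborel)
      = ennreal ((g (sqrt s - c) - g (sqrt s + c)) / (2 * c)) * indicator {0..} s"
    proof (cases "s \<ge> 0")
      case True
      have iff: "(c + x)\<^sup>2 \<le> s \<longleftrightarrow> x \<in> {- sqrt s - c .. sqrt s - c}" for x
      proof -
        have "(c + x)\<^sup>2 \<le> s \<longleftrightarrow> \<bar>c + x\<bar> \<le> sqrt s"
          using True by (metis real_sqrt_abs real_sqrt_le_iff)
        then show ?thesis by auto
      qed
      have "(\<integral>\<^sup>+x. (ennreal (exp ((c\<^sup>2 + 2 * c * x - s) / (2 * t)) / (2 * t * sqrt (2 * pi * t)))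
         * indicator {(c + x)\<^sup>2..} s) \<partial>lborel)
        = (\<integral>\<^sup>+x. (ennreal (exp ((c\<^sup>2 + 2 * c * x - s) / (2 * t)) / (2 * t * sqrt (2 * pi * t)))
         * indicator {- sqrt s - c .. sqrt s - c} x) \<partial>lborel)"
        by (intro nn_integral_cong) (simp add: indicator_def iff)
      also have "\<dots> = ennreal (?G (sqrt s - c) - ?G (- sqrt s - c))"
        using t c True
        by (intro nn_integral_FTC_Icc) (auto intro!: derivative_eq_intros simp: field_simps)
      \<comment> \<open>At either endpoint the exponent completes to a square, which brings
        \<open>g\<close> back.\<close>
      also have "?G (sqrt s - c) = g (sqrt s - c) / (2 * c)"
      proof -
        have "c\<^sup>2 + 2 * c * (sqrt s - c) - s = - (sqrt s - c)\<^sup>2"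
          using True by (simp add: power2_eq_square algebra_simps)
        then show ?thesis by (simp add: g_eq)
      qed
      also have "?G (- sqrt s - c) = g (sqrt s + c) / (2 * c)"
      proof -
        have "c\<^sup>2 + 2 * c * (- sqrt s - c) - s = - (sqrt s + c)\<^sup>2"
          using True by (simp add: power2_eq_square algebra_simps)
        then show ?thesis by (simp add: g_eq)
      qed
      finally show ?thesis
        using True by (simp add: diff_divide_distrib)
    next
      case False
      then have "\<not> (c + x)\<^sup>2 \<le> s" for x
        by (meson order_trans zero_le_power2)
      then show ?thesis using False by simp
    qed
    finally show "(\<integral>\<^sup>+x. h (sqrt s) * (ennreal (exp ((c\<^sup>2 + 2 * c * x - s) / (2 * t)) / (2 * t * sqrt (2 * pi * t)))
         * indicator {(c + x)\<^sup>2..} s) \<partial>lborel)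
      = h (sqrt s) * ennreal ((g (sqrt s - c) - g (sqrt s + c)) / (2 * c)) * indicator {0..} s"
      by (simp add: mult.assoc)
  qed
  \<comment> \<open>With \<open>s = r^2\<close> the Jacobian \<open>2 * r\<close> combines with
    \<open>1 / (2 * c)\<close> to give \<open>r / c\<close>.\<close>
  also have "\<dots> = (\<integral>\<^sup>+r. h (sqrt (r\<^sup>2)) * ennreal ((g (sqrt (r\<^sup>2) - c) - g (sqrt (r\<^sup>2) + c)) / (2 * c))
      * ennreal (2 * r) * indicator {0..} r \<partial>lborel)"
    by (rule nn_integral_square_substitution[symmetric]) (simp add: g_def)
  also have "\<dots> = (\<integral>\<^sup>+r. h r * ennreal (r / c * (g (r - c) - g (r + c))) * indicator {0..} r \<partial>lborel)"
  proof (intro nn_integral_cong)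
    fix r :: real
    have "ennreal ((g (r - c) - g (r + c)) / (2 * c)) * ennreal (2 * r) = ennreal (r / c * (g (r - c) - g (r + c)))"
      if "r \<ge> 0"
    proof -
      have "(g (r - c) - g (r + c)) / (2 * c) * (2 * r) = r / c * (g (r - c) - g (r + c))"
        using c(2) by (simp add: field_simps)
      then show ?thesis
        using that by (metis ennreal_mult'' mult_nonneg_nonneg zero_le_numeral)
    qed
    then show "h (sqrt (r\<^sup>2)) * ennreal ((g (sqrt (r\<^sup>2) - c) - g (sqrt (r\<^sup>2) + c)) / (2 * c))
        * ennreal (2 * r) * indicator {0..} r
      = h r * ennreal (r / c * (g (r - c) - g (r + c))) * indicator {0..} r"
      by (cases "r \<ge> 0") (simp_all add: mult.assoc)
  qed
  finally show ?thesis by (simp add: N_def)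
qed

section \<open>The normal distribution function and the call value in closed form\<close>

definition std_normal_cdf :: "real \<Rightarrow> real" where
  "std_normal_cdf = cdf (density lborel std_normal_density)"

lemma real_distribution_std_normal: "real_distribution (density lborel std_normal_density)"
  by (simp add: real_distribution_def real_distribution_axioms_def prob_space_normal_density)

lemma std_normal_cdf_at_top: "(std_normal_cdf \<longlongrightarrow> 1) at_top"
  unfolding std_normal_cdf_def
  by (rule real_distribution.cdf_lim_at_top_prob[OF real_distribution_std_normal])

lemma std_normal_cdf_at_bot: "(std_normal_cdf \<longlongrightarrow> 0) at_bot"
  unfolding std_normal_cdf_def
  by (rule finite_borel_measure.cdf_lim_at_bot[OF real_distribution.finite_borel_measure_M[OF real_distribution_std_normal]])

text \<open>Near \<open>x\<close> the distribution function is a constant plus an integral of the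
  continuous density from a fixed lower limit. The chain-rule form suits
  \<open>derivative_intros\<close>.\<close>

lemma std_normal_cdf_deriv [derivative_intros]:
  assumes "(f has_real_derivative f') (at x within S)"
  shows "((\<lambda>x. std_normal_cdf (f x)) has_real_derivative (std_normal_density (f x) * f')) (at x within S)"
proof -
  let ?M = "density lborel std_normal_density"
  interpret M: real_distribution ?M by (rule real_distribution_std_normal)
  have "(std_normal_cdf has_real_derivative std_normal_density x) (at x)" for x
  proof -
    let ?a = "x - 1" and ?b = "x + 1"
    let ?I = "\<lambda>u. LBINT y=?a..u. std_normal_density y"
    have "continuous_on {?a..?b} std_normal_density"
      unfolding std_normal_density_def by (intro continuous_intros) auto
    then have "(?I has_vector_derivative std_normal_density x) (at x within {?a..?b})"
      by (intro interval_integral_FTC2) auto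
    then have "(?I has_vector_derivative std_normal_density x) (at x)"
      by (simp add: at_within_Icc_at)
    then have I: "((\<lambda>u. std_normal_cdf ?a + ?I u) has_real_derivative std_normal_density x) (at x)"
      by (auto intro!: derivative_eq_intros simp: has_real_derivative_iff_has_vector_derivative)
    have "std_normal_cdf ?a + ?I u = std_normal_cdf u" if "u \<in> {?a<..<?b}" for u
    proof -
      have "?I u = (LBINT y:{?a<..u}. std_normal_density y)"
        using that by (intro interval_integral_Ioc) auto
      also have "\<dots> = enn2real (\<integral>\<^sup>+y. ennreal (indicator {?a<..u} y *\<^sub>R std_normal_density y) \<partial>lborel)"
        unfolding set_lebesgue_integral_def by (rule integral_eq_nn_integral) auto
      also have "\<dots> = measure ?M {?a<..u}"
        unfolding measure_def
        by (subst emeasure_density)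
           (auto intro!: arg_cong[where f=enn2real] nn_integral_cong split: split_indicator)
      also have "\<dots> = std_normal_cdf u - std_normal_cdf ?a"
        using that unfolding std_normal_cdf_def by (subst M.cdf_diff_eq) auto
      finally show ?thesis by simp
    qed
    then show ?thesis
      using has_field_derivative_transform_within_open[OF I, of "{?a<..<?b}" std_normal_cdf] by simp
  qed
  from DERIV_chain2[OF this assms] show ?thesis .
qed

lemma std_normal_density_minus: "std_normal_density (- x) = std_normal_density x"
  by (simp add: std_normal_density_def)

text \<open>The density is even, so \<open>?D\<close> has derivative 0; its constant value is read
  off at infinity.\<close>

lemma std_normal_cdf_minus: "std_normal_cdf (- x) = 1 - std_normal_cdf x"
proof -
  let ?D = "\<lambda>x. std_normal_cdf x + std_normal_cdf (- x)"
  have "(?D has_real_derivative 0) (at y)" for y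
    by (auto intro!: derivative_eq_intros simp: std_normal_density_minus)
  then have "?D y = ?D 0" for y
    by (intro DERIV_isconst_all[of ?D] allI)
  then obtain k where k: "?D y = k" for y
    by blast
  note std_normal_cdf_at_bot
  then have "((\<lambda>y. std_normal_cdf (- y)) \<longlongrightarrow> 0) at_top"
    by (rule filterlim_compose[OF _ filterlim_uminus_at_bot_at_top])
  then have "(?D \<longlongrightarrow> 1 + 0) at_top"
    by (intro tendsto_add std_normal_cdf_at_top)
  then have "k = 1"
    unfolding k by (simp add: tendsto_const_iff)
  with k[of x] show ?thesis by simp
qed

lemma std_normal_cdf_strict_mono: "x < y \<Longrightarrow> std_normal_cdf x < std_normal_cdf y"
  by (rule DERIV_pos_imp_increasing) (auto intro!: derivative_eq_intros exI normal_density_pos)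

lemma std_normal_density_deriv [derivative_intros]:
  assumes "(f has_real_derivative f') (at x within S)"
  shows "((\<lambda>x. std_normal_density (f x)) has_real_derivative (- f x * std_normal_density (f x) * f')) (at x within S)"
proof -
  define k where "k = 1 / sqrt (2 * pi)"
  have k: "std_normal_density x = k * exp (- x\<^sup>2 / 2)" for x
    by (simp add: std_normal_density_def k_def)
  show ?thesis
    unfolding k by (auto intro!: derivative_eq_intros assms)
qed

lemma normal_density_scale:
  "t > 0 \<Longrightarrow> normal_density 0 (sqrt t) x = std_normal_density (x / sqrt t) / sqrt t"
  by (simp add: normal_density_def real_sqrt_mult power_divide)

lemma std_normal_cdf_div_sqrt_deriv:
  assumes "t > 0"
  shows "((\<lambda>t. std_normal_cdf (c / sqrt t)) has_real_derivative - c / (2 * t) * normal_density 0 (sqrt t) c) (at t)"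
  unfolding normal_density_scale[OF assms]
  using assms by (auto intro!: derivative_eq_intros simp: field_simps)

text \<open>
  The two occurrences of \<open>call_part\<close> in \<open>call_value\<close> collect the upper boundary terms, at
  \<open>r = 1 / K\<close>, of the integral of \<open>(1 - K * r) * (g (r - 1) - g (r + 1))\<close>; the remaining terms come
  from \<open>r = 0\<close>. The division by \<open>K\<close> makes \<open>call_value\<close> meaningless for \<open>K = 0\<close>.
\<close>

definition call_part :: "real \<Rightarrow> real \<Rightarrow> real \<Rightarrow> real" where
  "call_part K c t = K * (c * std_normal_cdf (c / sqrt t) + sqrt t * std_normal_density (c / sqrt t))"

definition call_value :: "real \<Rightarrow> real \<Rightarrow> real" where
  "call_value K t = call_part K (1 / K - 1) t - call_part K (1 / K + 1) t
     - (1 - K) + 2 * std_normal_cdf (1 / sqrt t)"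

text \<open>\<open>call_part K c t\<close> is \<open>K\<close> times the mean positive part of a
  normal variable with mean \<open>c\<close> and variance \<open>t\<close>. The two terms in
  \<open>c^2\<close> cancel, leaving only the derivative of the factor
  \<open>sqrt t\<close>.\<close>

lemma call_part_deriv:
  assumes "t > 0"
  shows "(call_part K c has_real_derivative K / 2 * normal_density 0 (sqrt t) c) (at t)"
proof -
  have "(call_part K c has_real_derivative K * (c * (- c / (2 * t) * normal_density 0 (sqrt t) c)
     + (std_normal_density (c / sqrt t) / (2 * sqrt t)
     + sqrt t * (- (c / sqrt t) * std_normal_density (c / sqrt t) * (- c / (2 * t * sqrt t)))))) (at t)"
    unfolding call_part_def
    unfolding normal_density_scale[OF assms]
    using assms by (auto intro!: derivative_eq_intros simp: field_simps)
  also have "K * (c * (- c / (2 * t) * normal_density 0 (sqrt t) c)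
     + (std_normal_density (c / sqrt t) / (2 * sqrt t)
     + sqrt t * (- (c / sqrt t) * std_normal_density (c / sqrt t) * (- c / (2 * t * sqrt t)))))
     = K / 2 * normal_density 0 (sqrt t) c"
    using assms by (simp add: normal_density_scale field_simps)
  finally show ?thesis .
qed

lemma call_value_deriv:
  assumes "t > 0"
  shows "(call_value K has_real_derivative
     K / 2 * (normal_density 0 (sqrt t) (1 / K - 1) - normal_density 0 (sqrt t) (1 / K + 1))
     - normal_density 0 (sqrt t) 1 / t) (at t)"
  unfolding call_value_def
  using assms
  by (auto intro!: derivative_eq_intros call_part_deriv[OF assms] std_normal_cdf_div_sqrt_deriv[OF assms]
      simp: field_simps normal_density_scale[OF assms])

section \<open>Limits of the closed form as time tends to 0\<close>

lemma filterlim_inverse_sqrt: "filterlim (\<lambda>t::real. 1 / sqrt t) at_top (at_right 0)"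
proof -
  have "(sqrt \<longlongrightarrow> sqrt 0) (at_right 0)"
    by (intro tendsto_intros)
  then have "filterlim sqrt (at_right 0) (at_right 0)"
    by (auto simp: filterlim_at intro: eventually_mono[OF eventually_at_right_less])
  then show ?thesis
    using filterlim_compose[OF filterlim_inverse_at_top_right] by (simp add: inverse_eq_divide)
qed

lemma call_part_at_0:
  "(call_part K c \<longlongrightarrow> K * max c 0) (at_right 0)"
proof -
  have "((\<lambda>t. c * std_normal_cdf (c / sqrt t)) \<longlongrightarrow> max c 0) (at_right 0)"
  \<comment> \<open>The sign of \<open>c\<close> decides whether the argument tends to plus or minus
    infinity; for \<open>c = 0\<close> the factor \<open>c\<close> vanishes.\<close>
  proof (cases c "0::real" rule: linorder_cases)
    case greater
    have "filterlim (\<lambda>t. c / sqrt t) at_top (at_right 0)"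
      using filterlim_tendsto_pos_mult_at_top[of "\<lambda>_. c" c, OF _ greater filterlim_inverse_sqrt] by simp
    then have "((\<lambda>t. c * std_normal_cdf (c / sqrt t)) \<longlongrightarrow> c * 1) (at_right 0)"
      by (intro tendsto_intros filterlim_compose[OF std_normal_cdf_at_top])
    then show ?thesis using greater by simp
  next
    case less
    have "filterlim (\<lambda>t. c / sqrt t) at_bot (at_right 0)"
      using filterlim_tendsto_neg_mult_at_bot[of "\<lambda>_. c" c, OF _ less filterlim_inverse_sqrt] by simp
    then have "((\<lambda>t. c * std_normal_cdf (c / sqrt t)) \<longlongrightarrow> c * 0) (at_right 0)"
      by (intro tendsto_intros filterlim_compose[OF std_normal_cdf_at_bot])
    then show ?thesis using less by simp
  qed simp
  moreover have "((\<lambda>t. sqrt t * std_normal_density (c / sqrt t)) \<longlongrightarrow> 0) (at_right 0)"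
  \<comment> \<open>The density is bounded by its value \<open>1 / sqrt (2 * pi)\<close> at
    0.\<close>
  proof (rule Lim_null_comparison)
    have "((\<lambda>t. sqrt t * (1 / sqrt (2 * pi))) \<longlongrightarrow> sqrt 0 * (1 / sqrt (2 * pi))) (at_right 0)"
      by (intro tendsto_intros)
    then show "((\<lambda>t. sqrt t * (1 / sqrt (2 * pi))) \<longlongrightarrow> 0) (at_right 0)" by simp
    have "norm (sqrt t * std_normal_density (c / sqrt t)) \<le> sqrt t * (1 / sqrt (2 * pi))" if "t > 0" for t
      unfolding std_normal_density_def using that
      by (auto simp: abs_mult intro!: mult_left_mono divide_right_mono)
    then show "\<forall>\<^sub>F t in at_right 0. norm (sqrt t * std_normal_density (c / sqrt t)) \<le> sqrt t * (1 / sqrt (2 * pi))"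
      by (auto simp: eventually_at_right_less eventually_mono[OF eventually_at_right_less])
  qed
  ultimately have "(call_part K c \<longlongrightarrow> K * (max c 0 + 0)) (at_right 0)"
    unfolding call_part_def by (intro tendsto_intros)
  then show ?thesis by simp
qed

text \<open>The limit is the payoff at \<open>X 0 = 1\<close>, which links the closed form to the
  expectation at time 0.\<close>

lemma call_value_at_0:
  assumes "K > 0"
  shows "(call_value K \<longlongrightarrow> max (1 - K) 0) (at_right 0)"
proof -
  have "((\<lambda>t. std_normal_cdf (1 / sqrt t)) \<longlongrightarrow> 1) (at_right 0)"
    by (rule filterlim_compose[OF std_normal_cdf_at_top filterlim_inverse_sqrt])
  then have "(call_value K \<longlongrightarrow> K * max (1 / K - 1) 0 - K * max (1 / K + 1) 0 - (1 - K) + 2 * 1) (at_right 0)"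
    unfolding call_value_def by (intro tendsto_intros call_part_at_0)
  also have "K * max (1 / K - 1) 0 - K * max (1 / K + 1) 0 - (1 - K) + 2 * 1 = max (1 - K) 0"
    using assms by (auto simp: max_def field_simps)
  finally show ?thesis .
qed

text \<open>The point \<open>r - c\<close> is no farther from 0 than \<open>r + c\<close>. This
  makes the density of the Bessel process nonnegative.\<close>

lemma normal_density_shift_mono:
  assumes "0 \<le> r" "0 \<le> c"
  shows "normal_density 0 \<sigma> (r + c) \<le> normal_density 0 \<sigma> (r - c)"
proof -
  have "(r - c)\<^sup>2 \<le> (r + c)\<^sup>2"
    using assms by (simp add: power2_sum power2_diff)
  then show ?thesis
    by (simp add: normal_density_def divide_right_mono)
qed

text \<open>Payoff times density is \<open>(1 - K * r) * (g (r - 1) - g (r + 1))\<close> up to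
  \<open>r = 1 / K\<close> and 0 beyond. One explicit antiderivative yields both claims.\<close>

lemma
  assumes K: "K > 0" and t: "t > 0"
  shows call_value_nonneg: "call_value K t \<ge> 0"
    and nn_integral_call: "(\<integral>\<^sup>+r. ennreal (max (1 / r - K) 0) * ennreal (r *
        (normal_density 0 (sqrt t) (r - 1) - normal_density 0 (sqrt t) (r + 1))) * indicator {0..} r \<partial>lborel)
      = ennreal (call_value K t)"
proof -
  define g where "g = normal_density 0 (sqrt t)"
  define \<sigma> where "\<sigma> = sqrt t"
  have \<sigma>: "\<sigma> > 0" using t by (simp add: \<sigma>_def)
  \<comment> \<open>Found by writing \<open>1 - K * y\<close> as
    \<open>(1 - K) - K * (y - 1)\<close> in the first Gaussian and as
    \<open>(1 + K) - K * (y + 1)\<close> in the second.\<close>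
  let ?G = "\<lambda>y. (1 - K) * std_normal_cdf ((y - 1) / \<sigma>) + K * \<sigma> * std_normal_density ((y - 1) / \<sigma>)
     - ((1 + K) * std_normal_cdf ((y + 1) / \<sigma>) + K * \<sigma> * std_normal_density ((y + 1) / \<sigma>))"
  have g: "g x = std_normal_density (x / \<sigma>) / \<sigma>" for x
    using t by (simp add: g_def \<sigma>_def normal_density_scale)
  have g_mono: "g (r + 1) \<le> g (r - 1)" if "r \<ge> 0" for r
    using that by (simp add: g_def normal_density_shift_mono)
  have deriv: "(?G has_real_derivative (1 - K * y) * (g (y - 1) - g (y + 1))) (at y)" for y
    using \<sigma> by (auto intro!: derivative_eq_intros simp: g field_simps)
  have nonneg: "0 \<le> (1 - K * y) * (g (y - 1) - g (y + 1))" if "0 \<le> y" "y \<le> 1 / K" for y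
    using that K g_mono[of y] by (intro mult_nonneg_nonneg) (auto simp: field_simps)
  have G_diff: "?G (1 / K) - ?G 0 = call_value K t"
  proof -
    have "?G (1 / K) = call_part K (1 / K - 1) t - call_part K (1 / K + 1) t"
      using K by (simp add: call_part_def \<sigma>_def algebra_simps)
    moreover have "?G 0 = (1 - K) - 2 * std_normal_cdf (1 / sqrt t)"
      by (simp add: \<sigma>_def std_normal_cdf_minus std_normal_density_minus algebra_simps)
    ultimately show ?thesis by (simp add: call_value_def)
  qed
  have "?G 0 \<le> ?G (1 / K)"
    by (rule DERIV_nonneg_imp_nondecreasing) (use K deriv nonneg in \<open>auto intro!: exI\<close>)
  then show "call_value K t \<ge> 0"
    unfolding G_diff[symmetric] by simp
  have "(\<integral>\<^sup>+r. ennreal (max (1 / r - K) 0) * ennreal (r * (g (r - 1) - g (r + 1))) * indicator {0..} r \<partial>lborel)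
     = (\<integral>\<^sup>+r. ennreal ((1 - K * r) * (g (r - 1) - g (r + 1))) * indicator {0..1 / K} r \<partial>lborel)"
  \<comment> \<open>Away from the null set \<open>{0}\<close> the factor \<open>r\<close> cancels
    against \<open>1 / r\<close>.\<close>
  proof (intro nn_integral_cong_AE AE_I[where N="{0}"] subsetI)
    fix r assume r: "r \<in> {r \<in> space lborel. ennreal (max (1 / r - K) 0) * ennreal (r * (g (r - 1) - g (r + 1))) * indicator {0..} r
      \<noteq> ennreal ((1 - K * r) * (g (r - 1) - g (r + 1))) * indicator {0..1 / K} r}"
    have "ennreal (max (1 / r - K) 0) * ennreal (r * (g (r - 1) - g (r + 1))) * indicator {0..} r
      = ennreal ((1 - K * r) * (g (r - 1) - g (r + 1))) * indicator {0..1 / K} r" if "r \<noteq> 0"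
    proof (cases "r > 0")
      case True
      have e1: "max (1 / r - K) 0 * (r * (g (r - 1) - g (r + 1))) = max (1 - K * r) 0 * (g (r - 1) - g (r + 1))"
        using True by (auto simp: max_def field_simps)
      have e2: "r \<le> 1 / K \<longleftrightarrow> 0 \<le> 1 - K * r"
        using K by (simp add: field_simps)
      have e3: "ennreal (max (1 / r - K) 0) * ennreal (r * (g (r - 1) - g (r + 1)))
          = ennreal (max (1 / r - K) 0 * (r * (g (r - 1) - g (r + 1))))"
        by (simp only: ennreal_mult' max.cobounded2)
      show ?thesis
        unfolding e3 e1 using True e2 by (cases "r \<le> 1 / K") simp_all
    qed (use that in simp)
    with r show "r \<in> {0}" by auto
  qed auto
  also have "\<dots> = ennreal (?G (1 / K) - ?G 0)"
    by (rule nn_integral_FTC_Icc) (use K deriv nonneg in \<open>auto simp: g_def\<close>)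
  finally have "(\<integral>\<^sup>+r. ennreal (max (1 / r - K) 0) * ennreal (r * (g (r - 1) - g (r + 1))) * indicator {0..} r \<partial>lborel)
     = ennreal (?G (1 / K) - ?G 0)" .
  then show "(\<integral>\<^sup>+r. ennreal (max (1 / r - K) 0) * ennreal (r *
        (normal_density 0 (sqrt t) (r - 1) - normal_density 0 (sqrt t) (r + 1))) * indicator {0..} r \<partial>lborel)
      = ennreal (call_value K t)"
    unfolding G_diff g_def .
qed

text \<open>For strike 0 the payoff never vanishes on \<open>r > 0\<close>, so the upper boundary
  term is a limit at infinity, where the two distribution functions cancel.\<close>

lemma nn_integral_call_strike_0:
  assumes t: "t > 0"
  defines "g \<equiv> normal_density 0 (sqrt t)"
  shows "(\<integral>\<^sup>+r. ennreal (max (1 / r) 0) * ennreal (r * (g (r - 1) - g (r + 1))) * indicator {0..} r \<partial>lborel)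
       = ennreal (2 * std_normal_cdf (1 / sqrt t) - 1)"
proof -
  define \<sigma> where "\<sigma> = sqrt t"
  have \<sigma>: "\<sigma> > 0" using t by (simp add: \<sigma>_def)
  let ?G = "\<lambda>y. std_normal_cdf ((y - 1) / \<sigma>) - std_normal_cdf ((y + 1) / \<sigma>)"
  have g: "g x = std_normal_density (x / \<sigma>) / \<sigma>" for x
    using t by (simp add: g_def \<sigma>_def normal_density_scale)
  have g_mono: "g (r + 1) \<le> g (r - 1)" if "r \<ge> 0" for r
    using that by (simp add: g_def normal_density_shift_mono)
  have "(\<integral>\<^sup>+r. ennreal (max (1 / r) 0) * ennreal (r * (g (r - 1) - g (r + 1))) * indicator {0..} r \<partial>lborel)
     = (\<integral>\<^sup>+r. ennreal (g (r - 1) - g (r + 1)) * indicator {0..} r \<partial>lborel)"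
    by (intro nn_integral_cong_AE AE_I[where N="{0}"])
       (auto simp: ennreal_mult'[symmetric] max_def split: split_indicator_asm)
  also have "\<dots> = ennreal (0 - ?G 0)"
  proof (rule nn_integral_FTC_atLeast)
    show "(?G has_real_derivative g (y - 1) - g (y + 1)) (at y)" for y
      using \<sigma> by (auto intro!: derivative_eq_intros simp: g field_simps)
    have "filterlim (\<lambda>y. (y + c) / \<sigma>) at_top at_top" for c
    proof -
      have "filterlim (\<lambda>y. c + y) at_top at_top"
        by (rule filterlim_tendsto_add_at_top[where c=c]) (auto intro: filterlim_ident)
      then have "filterlim (\<lambda>y. 1 / \<sigma> * (c + y)) at_top at_top"
        using \<sigma> by (intro filterlim_tendsto_pos_mult_at_top[where c="1 / \<sigma>"]) auto
      then show ?thesis by (simp add: add.commute)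
    qed
    from filterlim_compose[OF std_normal_cdf_at_top this]
    have "((\<lambda>y. std_normal_cdf ((y + c) / \<sigma>)) \<longlongrightarrow> 1) at_top" for c .
    from tendsto_diff[OF this[of "-1"] this[of 1]] show "(?G \<longlongrightarrow> 0) at_top" by simp
  qed (auto simp: g_def normal_density_shift_mono)
  also have "0 - ?G 0 = 2 * std_normal_cdf (1 / sqrt t) - 1"
    using std_normal_cdf_minus[of "1 / \<sigma>"] by (simp add: \<sigma>_def)
  finally show ?thesis .
qed

section \<open>The sign of the time derivative\<close>

text \<open>
  Normalised so that the sign of the time derivative of \<open>call_value K\<close> at \<open>t\<close> is that of
  \<open>drift_ratio K u - u\<close> at \<open>u = 1 / t\<close>.
\<close>

definition drift_ratio :: "real \<Rightarrow> real \<Rightarrow> real" where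
  "drift_ratio K u = K * exp (- u / (2 * K\<^sup>2)) * sinh (u / K)"

text \<open>Expanding the squares of \<open>1 / K - 1\<close> and \<open>1 / K + 1\<close> splits
  off the density at 1 and the factor \<open>exp (- u / (2 * K^2))\<close>; the cross terms combine
  to \<open>sinh (u / K)\<close>.\<close>

lemma call_value_deriv_drift_ratio:
  assumes "K > 0" "t > 0"
  shows "(call_value K has_real_derivative normal_density 0 (sqrt t) 1 * (drift_ratio K (1 / t) - 1 / t)) (at t)"
proof -
  define Z where "Z = sqrt (2 * pi * t)"
  \<comment> \<open>The sign \<open>s\<close> is 1 or -1, which handles both Gaussians at
    once.\<close>
  have expand: "normal_density 0 (sqrt t) (1 / K + s)
      = exp (- 1 / (2 * t)) * exp (- (1 / t) / (2 * K\<^sup>2)) * exp (- s * (1 / t / K)) / Z" if "s\<^sup>2 = 1" for s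
  proof -
    have "- (1 / K + s)\<^sup>2 / (2 * t) = - 1 / (2 * t) + - (1 / t) / (2 * K\<^sup>2) + - s * (1 / t / K)"
      using assms that by (simp add: power2_sum power_divide) (simp add: field_simps power2_eq_square)
    then have "exp (- (1 / K + s)\<^sup>2 / (2 * t)) = exp (- 1 / (2 * t)) * exp (- (1 / t) / (2 * K\<^sup>2)) * exp (- s * (1 / t / K))"
      by (simp only: exp_add)
    then show ?thesis
      using assms by (simp add: normal_density_def Z_def)
  qed
  define A E P N where "A = exp (- 1 / (2 * t))" and "E = exp (- (1 / t) / (2 * K\<^sup>2))"
    and "P = exp (1 / t / K)" and "N = exp (- (1 / t / K))"
  note defs = this
  have n1: "normal_density 0 (sqrt t) (1 / K - 1) = A * E * P / Z"
    using expand[of "- 1"] by (simp add: defs)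
  have n2: "normal_density 0 (sqrt t) (1 / K + 1) = A * E * N / Z"
    using expand[of 1] by (simp add: defs)
  have n3: "normal_density 0 (sqrt t) 1 = A / Z"
    using assms by (simp add: normal_density_def A_def Z_def)
  have n4: "drift_ratio K (1 / t) = K * E * ((P - N) / 2)"
    by (simp add: drift_ratio_def sinh_field_def E_def P_def N_def)
  have "K / 2 * (normal_density 0 (sqrt t) (1 / K - 1) - normal_density 0 (sqrt t) (1 / K + 1))
     - normal_density 0 (sqrt t) 1 / t = normal_density 0 (sqrt t) 1 * (drift_ratio K (1 / t) - 1 / t)"
    unfolding n1 n2 n3 n4 by (simp add: algebra_simps diff_divide_distrib)
  then show ?thesis
    using call_value_deriv[of t K] assms by simp
qed

text \<open>For \<open>K\<close> at most 1/2 the damping is at least that of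
  \<open>exp (- x)\<close> with \<open>x = u / K\<close>, and
  \<open>exp (- x) * sinh x = (1 - exp (- 2 * x)) / 2\<close> is less than \<open>x\<close>.\<close>

lemma drift_ratio_less_small_strike:
  assumes "0 < K" "K \<le> 1 / 2" "u > 0"
  shows "drift_ratio K u < u"
proof -
  have "u / K \<le> u / (2 * K\<^sup>2)"
    using assms by (simp add: field_simps power2_eq_square)
  then have "drift_ratio K u \<le> K * exp (- (u / K)) * sinh (u / K)"
    using assms unfolding drift_ratio_def
    by (intro mult_right_mono mult_left_mono) auto
  also have "\<dots> = K * (1 - exp (- (2 * u / K))) / 2"
    by (simp add: sinh_def algebra_simps mult_exp_exp)
  also have "\<dots> < K * (2 * u / K) / 2"
    using assms exp_minus_greater[of "2 * u / K"] by (simp add: field_simps)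
  finally show ?thesis using assms by simp
qed

text \<open>
  The bound on \<open>u\<close> is the inflection point of \<open>drift_ratio K\<close>, which is strictly concave before it
  and tangent to the diagonal at 0.
\<close>

lemma drift_ratio_less:
  assumes K: "K > 1 / 2" and u: "0 < u" "u \<le> K * ln ((2 * K + 1) / (2 * K - 1))"
  shows "drift_ratio K u < u"
proof -
  define a where "a = 1 / K"
  have a: "0 < a" "a < 2" and Ka: "K * a = 1"
    using K by (auto simp: a_def field_simps)
  let ?E = "\<lambda>v. exp (- a\<^sup>2 * v / 2)"
  \<comment> \<open>The derivative of \<open>drift_ratio K\<close>, with \<open>K * a = 1\<close>
    already cancelled.\<close>
  define D where "D = (\<lambda>v. ?E v * (cosh (a * v) - a / 2 * sinh (a * v)))"
  have ratio: "drift_ratio K = (\<lambda>v. K * ?E v * sinh (a * v))"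
    by (simp add: drift_ratio_def a_def power_divide fun_eq_iff)
  have d1: "(drift_ratio K has_real_derivative D v) (at v)" for v
  proof -
    have "(drift_ratio K has_real_derivative K * (?E v * (cosh (a * v) * a) + ?E v * (- a\<^sup>2 / 2) * sinh (a * v))) (at v)"
      unfolding ratio by (auto intro!: derivative_eq_intros simp: algebra_simps)
    also have "K * (?E v * (cosh (a * v) * a) + ?E v * (- a\<^sup>2 / 2) * sinh (a * v))
       = ?E v * ((K * a) * cosh (a * v) - (K * a) * (a / 2) * sinh (a * v))"
      by (simp add: algebra_simps power2_eq_square)
    finally show ?thesis by (simp add: Ka D_def)
  qed
  have d2: "(D has_real_derivative a * ?E v * ((1 + a\<^sup>2 / 4) * sinh (a * v) - a * cosh (a * v))) (at v)" for v
  proof -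
    have alg: "e * (s * a - a / 2 * (c * a)) + e * (- a\<^sup>2 / 2) * (c - a / 2 * s)
      = a * e * ((1 + a\<^sup>2 / 4) * s - a * c)" for e s c
      by (simp add: field_simps power2_eq_square)
    have "(D has_real_derivative ?E v * (sinh (a * v) * a - a / 2 * (cosh (a * v) * a))
        + ?E v * (- a\<^sup>2 / 2) * (cosh (a * v) - a / 2 * sinh (a * v))) (at v)"
      unfolding D_def by (auto intro!: derivative_eq_intros simp: field_simps power2_eq_square)
    also have "?E v * (sinh (a * v) * a - a / 2 * (cosh (a * v) * a))
        + ?E v * (- a\<^sup>2 / 2) * (cosh (a * v) - a / 2 * sinh (a * v))
      = a * ?E v * ((1 + a\<^sup>2 / 4) * sinh (a * v) - a * cosh (a * v))"
      by (rule alg)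
    finally show ?thesis .
  qed
  \<comment> \<open>In exponentials, the sign is that of
    \<open>(2 - a)^2 * exp (a * v) - (2 + a)^2 * exp (- (a * v))\<close>. It is negative as long as
    \<open>exp (a * v)\<close> is below \<open>(2 + a) / (2 - a)\<close>, which is the logarithmic
    bound on \<open>u\<close>.\<close>
  have neg: "a * ?E v * ((1 + a\<^sup>2 / 4) * sinh (a * v) - a * cosh (a * v)) < 0" if "v < u" for v
  proof -
    have "v < K * ln ((2 * K + 1) / (2 * K - 1))" using that u by simp
    then have "a * v < (K * a) * ln ((2 * K + 1) / (2 * K - 1))"
      using a by (simp add: mult.commute)
    also have "\<dots> = ln ((2 + a) / (2 - a))"
    proof -
      have "2 + a = a * (2 * K + 1)" "2 - a = a * (2 * K - 1)"
        using Ka by (simp_all add: algebra_simps)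
      then show ?thesis using a Ka by simp
    qed
    finally have "exp (a * v) < (2 + a) / (2 - a)"
      using a by (metis add_pos_pos diff_gt_0_iff_gt divide_pos_pos exp_less_mono exp_ln zero_less_numeral)
    then have "(2 - a) * exp (a * v) < 2 + a"
      using a by (simp add: field_simps)
    then have "((2 - a) * exp (a * v))\<^sup>2 < (2 + a)\<^sup>2"
      using a by (intro power_strict_mono) auto
    then have "((2 - a) * exp (a * v))\<^sup>2 * exp (- (a * v)) < (2 + a)\<^sup>2 * exp (- (a * v))"
      by simp
    then have "(2 - a)\<^sup>2 * exp (a * v) < (2 + a)\<^sup>2 * exp (- (a * v))"
      by (simp add: power_mult_distrib power2_eq_square[of "exp _"] mult.assoc mult_exp_exp)
    then have "(1 + a\<^sup>2 / 4) * sinh (a * v) - a * cosh (a * v) < 0"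
      by (simp add: sinh_def cosh_def power2_sum power2_diff algebra_simps)
    then show ?thesis
      using a by (simp add: mult_pos_neg)
  qed
  \<comment> \<open>\<open>D\<close> starts from \<open>D 0 = 1\<close>, the slope of the diagonal,
    and strictly decreases.\<close>
  have D_less: "D v < 1" if "0 < v" "v < u" for v
  proof -
    have "D v < D 0"
      by (rule DERIV_neg_imp_decreasing[OF that(1)]) (use that d2 neg in \<open>meson le_less_trans\<close>)
    then show ?thesis by (simp add: D_def)
  qed
  have "drift_ratio K u - u < drift_ratio K 0 - 0"
  \<comment> \<open>The slope of the difference is 0 at 0, hence the version with derivatives on the
    open interval.\<close>
  proof (rule DERIV_neg_imp_decreasing_open[OF u(1)])
    show "\<exists>y. ((\<lambda>v. drift_ratio K v - v) has_real_derivative y) (at v) \<and> y < 0" if "0 < v" "v < u" for v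
      using DERIV_diff[OF d1[of v] DERIV_ident] D_less[OF that] by (intro exI[of _ "D v - 1"]) auto
    show "continuous_on {0..u} (\<lambda>v. drift_ratio K v - v)"
      using DERIV_diff[OF d1 DERIV_ident] by (rule DERIV_atLeastAtMost_imp_continuous_on[OF exI])
  qed
  then show ?thesis by (simp add: drift_ratio_def)
qed

text \<open>For \<open>K > 1/2\<close> the growth rate \<open>1 / K\<close> of \<open>sinh\<close>
  exceeds the damping rate \<open>1 / (2 * K^2)\<close>, so exponential growth beats the
  diagonal.\<close>

lemma drift_ratio_greater_eventually:
  assumes K: "K > 1 / 2"
  obtains U where "U > 0" "\<And>u. u \<ge> U \<Longrightarrow> drift_ratio K u > u"
proof -
  define b where "b = 1 / K - 1 / (2 * K\<^sup>2)"
  have b: "b > 0"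
    using K by (simp add: b_def field_simps power2_eq_square)
  \<comment> \<open>The threshold is where the quadratic Taylor term,
    \<open>K / 2 * ((b * u)^2 / 2)\<close>, reaches \<open>u\<close>.\<close>
  have "drift_ratio K u > u" if u: "u \<ge> 4 / (K * b\<^sup>2)" for u
  proof -
    have u0: "u > 0"
      using u b K by (smt (verit) divide_pos_pos mult_pos_pos zero_less_power)
    have exp_b: "exp (b * u) \<ge> 1 + b * u + (b * u)\<^sup>2 / 2"
      using b u0 by (intro exp_lower_Taylor_quadratic) auto
    have "exp (- (u / K + u / (2 * K\<^sup>2))) \<le> 1"
      using u0 K by (subst exp_le_one_iff) (simp only: neg_le_0_iff_le, intro add_nonneg_nonneg, auto)
    \<comment> \<open>The constant 1 of the Taylor bound absorbs the decaying exponential, and the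
      linear term gives strictness.\<close>
    then have "(b * u)\<^sup>2 / 2 < exp (b * u) - exp (- (u / K + u / (2 * K\<^sup>2)))"
      using exp_b mult_pos_pos[OF b u0] by linarith
    then have "K / 2 * ((b * u)\<^sup>2 / 2) < K / 2 * (exp (b * u) - exp (- (u / K + u / (2 * K\<^sup>2))))"
      using K by (intro mult_strict_left_mono) auto
    moreover have "drift_ratio K u = K / 2 * (exp (b * u) - exp (- (u / K + u / (2 * K\<^sup>2))))"
      by (simp add: drift_ratio_def sinh_def b_def algebra_simps mult_exp_exp)
    moreover have "u \<le> K / 2 * ((b * u)\<^sup>2 / 2)"
      using u K b u0 by (simp add: field_simps power2_eq_square)
    ultimately show ?thesis by linarith
  qed
  moreover have "4 / (K * b\<^sup>2) > 0" using K b by simp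
  ultimately show thesis using that by blast
qed

section \<open>Monotonicity of the closed form in time\<close>

lemma call_value_strict_antimono:
  assumes K: "K > 0" and S: "S \<subseteq> {0<..}" "is_interval S"
    and neg: "\<And>t. t \<in> S \<Longrightarrow> drift_ratio K (1 / t) < 1 / t"
  shows "strict_antimono_on S (call_value K)"
proof (rule monotone_onI)
  fix s t assume st: "s \<in> S" "t \<in> S" "s < t"
  show "call_value K t < call_value K s"
  proof (rule DERIV_neg_imp_decreasing[OF st(3)])
    fix v assume v: "s \<le> v" "v \<le> t"
    then have "v \<in> S"
      using st S(2) by (meson mem_is_interval_1_I)
    moreover from this have "v > 0" using S by auto
    ultimately show "\<exists>y. (call_value K has_real_derivative y) (at v) \<and> y < 0"
      using call_value_deriv_drift_ratio[OF K] neg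
      by (intro exI[of _ "normal_density 0 (sqrt v) 1 * (drift_ratio K (1 / v) - 1 / v)"])
         (auto intro!: mult_pos_neg normal_density_pos)
  qed
qed

text \<open>Large \<open>u\<close> means small \<open>t\<close>. The last conclusion prepares for
  time 0, where \<open>call_value\<close> divides by zero and only its limit is meaningful.\<close>

lemma call_value_strict_mono_near_0:
  assumes K: "K > 1 / 2"
  obtains \<epsilon> where "\<epsilon> > 0" "strict_mono_on {0<..<\<epsilon>} (call_value K)"
    "\<And>t. t \<in> {0<..<\<epsilon>} \<Longrightarrow> max (1 - K) 0 < call_value K t"
proof -
  obtain U where U: "U > 0" "\<And>u. u \<ge> U \<Longrightarrow> drift_ratio K u > u"
    using drift_ratio_greater_eventually[OF K] by blast
  have incr: "call_value K s < call_value K t" if st: "0 < s" "s < t" "t < 1 / U" for s t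
  proof (rule DERIV_pos_imp_increasing[OF st(2)])
    fix v assume v: "s \<le> v" "v \<le> t"
    then have "v > 0" "1 / v \<ge> U"
      using st U(1) by (auto simp: field_simps) (smt (verit, best) mult_left_mono)
    then show "\<exists>y. (call_value K has_real_derivative y) (at v) \<and> 0 < y"
      using call_value_deriv_drift_ratio[of K v] K U(2)[of "1 / v"]
      by (intro exI[of _ "normal_density 0 (sqrt v) 1 * (drift_ratio K (1 / v) - 1 / v)"])
         (auto intro!: mult_pos_pos normal_density_pos)
  qed
  \<comment> \<open>The limit only gives a weak inequality; comparing it with the value at
    \<open>t / 2\<close> first makes it strict at \<open>t\<close>.\<close>
  have "max (1 - K) 0 < call_value K t" if t: "t \<in> {0<..<1 / U}" for t
  proof -
    have "\<forall>\<^sub>F s in at_right 0. s \<in> {0<..<t / 2}"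
      using t by (intro eventually_at_right_real) auto
    then have "\<forall>\<^sub>F s in at_right 0. call_value K s \<le> call_value K (t / 2)"
      by (rule eventually_mono) (use t in \<open>auto intro!: less_imp_le incr\<close>)
    then have "max (1 - K) 0 \<le> call_value K (t / 2)"
      using K by (intro tendsto_upperbound[OF call_value_at_0]) auto
    also have "\<dots> < call_value K t"
      using t by (intro incr) auto
    finally show ?thesis .
  qed
  moreover have "strict_mono_on {0<..<1 / U} (call_value K)"
    by (rule monotone_onI) (auto intro: incr)
  ultimately show thesis
    using U(1) by (intro that[of "1 / U"]) auto
qed

section \<open>Expectations under the Bessel process\<close>

text \<open>The law determines expectations at a single time, which moves them from \<open>X\<close>
  to the norm of a Brownian motion on another space.\<close>

lemma nn_integral_process_law:
  fixes h :: "real \<Rightarrow> ennreal"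
  assumes X: "\<And>t. 0 \<le> t \<Longrightarrow> X t \<in> borel_measurable M" and t: "0 \<le> t"
    and [measurable]: "h \<in> borel_measurable borel"
  shows "(\<integral>\<^sup>+\<omega>. h (X t \<omega>) \<partial>M) = (\<integral>\<^sup>+f. h (f t) \<partial>process_law M X)"
proof -
  have "(\<lambda>\<omega>. restrict (\<lambda>t. X t \<omega>) {0..}) \<in> measurable M (Pi\<^sub>M {0..} (\<lambda>_. borel))"
    using X by (intro measurable_restrict) auto
  moreover have "(\<lambda>f. h (f t)) \<in> borel_measurable (Pi\<^sub>M {0..} (\<lambda>_. borel))"
    using t by (intro measurable_compose[OF measurable_component_singleton[of t] assms(3)]) simp
  ultimately show ?thesis
    unfolding process_law_def using t by (simp add: nn_integral_distr)
qed

text \<open>Almost surely \<open>B t\<close> is \<open>p\<close> plus the increment from time 0,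
  whose density is given.\<close>

lemma brownian_motion_nn_integral:
  fixes h :: "real ^ 'n \<Rightarrow> ennreal"
  assumes B: "brownian_motion N B p" and t: "t > 0"
    and [measurable]: "h \<in> borel_measurable borel"
  shows "(\<integral>\<^sup>+\<omega>. h (B t \<omega>) \<partial>N)
       = (\<integral>\<^sup>+v. h (p + v) * ennreal (\<Prod>i\<in>UNIV. normal_density 0 (sqrt t) (v $ i)) \<partial>lborel)"
proof -
  have start: "AE \<omega> in N. B 0 \<omega> = p"
    using B by (simp add: brownian_motion_def)
  have "distributed N lborel (\<lambda>\<omega>. B t \<omega> - B 0 \<omega>)
      (\<lambda>x. ennreal (\<Prod>i\<in>UNIV. normal_density 0 (sqrt (t - 0)) (x $ i)))"
    using B t unfolding brownian_motion_def by blast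
  from distributed_nn_integral[OF this, of "\<lambda>v. h (p + v)"]
  have "(\<integral>\<^sup>+\<omega>. h (p + (B t \<omega> - B 0 \<omega>)) \<partial>N)
      = (\<integral>\<^sup>+v. h (p + v) * ennreal (\<Prod>i\<in>UNIV. normal_density 0 (sqrt t) (v $ i)) \<partial>lborel)"
    by (simp add: mult.commute)
  moreover have "(\<integral>\<^sup>+\<omega>. h (B t \<omega>) \<partial>N) = (\<integral>\<^sup>+\<omega>. h (p + (B t \<omega> - B 0 \<omega>)) \<partial>N)"
    by (rule nn_integral_cong_AE) (use start in eventually_elim, simp)
  ultimately show ?thesis by simp
qed

lemma BES3_nn_integral:
  fixes h :: "real \<Rightarrow> ennreal"
  assumes X: "BES3 M X x0" and x0: "x0 > 0" and t: "t > 0"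
    and [measurable]: "h \<in> borel_measurable borel"
  defines "g \<equiv> normal_density 0 (sqrt t)"
  shows "(\<integral>\<^sup>+\<omega>. h (X t \<omega>) \<partial>M)
       = (\<integral>\<^sup>+r. h r * ennreal (r / x0 * (g (r - x0) - g (r + x0))) * indicator {0..} r \<partial>lborel)"
proof -
  from X obtain N :: "(real \<Rightarrow> real ^ 3) measure" and B and p :: "real ^ 3"
    where B: "brownian_motion N B p" and p: "norm p = x0"
      and law: "process_law M X = process_law N (\<lambda>t \<omega>. norm (B t \<omega>))"
    unfolding BES3_def by blast
  have "(\<integral>\<^sup>+\<omega>. h (X t \<omega>) \<partial>M) = (\<integral>\<^sup>+\<omega>. h (norm (B t \<omega>)) \<partial>N)"
    using X B t
    by (subst (1 2) nn_integral_process_law) (auto simp: BES3_def brownian_motion_def law)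
  also have "\<dots> = (\<integral>\<^sup>+v. h (norm (p + v)) * ennreal (\<Prod>i\<in>UNIV. normal_density 0 (sqrt t) (v $ i)) \<partial>lborel)"
    by (rule brownian_motion_nn_integral[OF B t]) auto
  also have "\<dots> = (\<integral>\<^sup>+r. h r * ennreal (r / x0 * (g (r - x0) - g (r + x0))) * indicator {0..} r \<partial>lborel)"
    unfolding g_def by (rule nn_integral_norm_gaussian_3) (use t p x0 in auto)
  finally show ?thesis .
qed

text \<open>The starting value enters \<open>BES3\<close> only through the law, so it is recovered
  by integrating the indicator of its complement at time 0.\<close>

lemma BES3_start:
  assumes X: "BES3 M X x0"
  shows "AE \<omega> in M. X 0 \<omega> = x0"
proof -
  from X obtain N :: "(real \<Rightarrow> real ^ 3) measure" and B and p :: "real ^ 3"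
    where B: "brownian_motion N B p" and p: "norm p = x0"
      and law: "process_law M X = process_law N (\<lambda>t \<omega>. norm (B t \<omega>))"
    unfolding BES3_def by blast
  have [measurable]: "X 0 \<in> borel_measurable M"
    using X by (simp add: BES3_def)
  let ?h = "indicator (- {x0}) :: real \<Rightarrow> ennreal"
  have "(\<integral>\<^sup>+\<omega>. ?h (X 0 \<omega>) \<partial>M) = (\<integral>\<^sup>+\<omega>. ?h (norm (B 0 \<omega>)) \<partial>N)"
    using X B
    by (subst (1 2) nn_integral_process_law) (auto simp: BES3_def brownian_motion_def law)
  also have "\<dots> = (\<integral>\<^sup>+\<omega>. 0 \<partial>N)"
    using B p by (intro nn_integral_cong_AE) (auto simp: brownian_motion_def)
  finally have "AE \<omega> in M. ?h (X 0 \<omega>) = 0"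
    by (subst nn_integral_0_iff_AE[symmetric]) auto
  then show ?thesis
    by eventually_elim (simp add: indicator_def split: if_splits)
qed

text \<open>For a nonnegative measurable function this conversion presupposes no integrability.
  Finiteness comes with the closed forms, which are real numbers.\<close>

lemma BES3_call_expectation:
  assumes X: "BES3 M X 1" and t: "t > 0"
  shows "(\<integral>\<omega>. max (1 / X t \<omega> - K) 0 \<partial>M)
     = enn2real (\<integral>\<^sup>+r. ennreal (max (1 / r - K) 0) * ennreal (r *
         (normal_density 0 (sqrt t) (r - 1) - normal_density 0 (sqrt t) (r + 1))) * indicator {0..} r \<partial>lborel)"
proof -
  have [measurable]: "X t \<in> borel_measurable M"
    using X t by (simp add: BES3_def)
  have "(\<integral>\<omega>. max (1 / X t \<omega> - K) 0 \<partial>M) = enn2real (\<integral>\<^sup>+\<omega>. ennreal (max (1 / X t \<omega> - K) 0) \<partial>M)"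
    by (rule integral_eq_nn_integral) auto
  also have "(\<integral>\<^sup>+\<omega>. ennreal (max (1 / X t \<omega> - K) 0) \<partial>M)
     = (\<integral>\<^sup>+r. ennreal (max (1 / r - K) 0) * ennreal (r / 1 *
         (normal_density 0 (sqrt t) (r - 1) - normal_density 0 (sqrt t) (r + 1))) * indicator {0..} r \<partial>lborel)"
    by (rule BES3_nn_integral[OF X zero_less_one t]) auto
  finally show ?thesis by (simp only: div_by_1)
qed

lemma BES3_call:
  assumes "BES3 M X 1" "t > 0" "K > 0"
  shows "(\<integral>\<omega>. max (1 / X t \<omega> - K) 0 \<partial>M) = call_value K t"
  unfolding BES3_call_expectation[OF assms(1,2)] nn_integral_call[OF assms(3,2)]
  by (rule enn2real_ennreal[OF call_value_nonneg[OF assms(3,2)]])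

lemma BES3_call_strike_0:
  assumes "BES3 M X 1" "t > 0"
  shows "(\<integral>\<omega>. max (1 / X t \<omega> - 0) 0 \<partial>M) = 2 * std_normal_cdf (1 / sqrt t) - 1"
proof -
  \<comment> \<open>Nonnegativity of the closed form is needed to remove
    \<open>enn2real\<close>.\<close>
  have "std_normal_cdf (- (1 / sqrt t)) < std_normal_cdf (1 / sqrt t)"
    using assms by (intro std_normal_cdf_strict_mono) simp
  then have "2 * std_normal_cdf (1 / sqrt t) - 1 \<ge> 0"
    by (simp add: std_normal_cdf_minus)
  then show ?thesis
    unfolding BES3_call_expectation[OF assms] unfolding diff_0_right nn_integral_call_strike_0[OF assms(2)]
    by (rule enn2real_ennreal)
qed

lemma BES3_call_at_0:
  assumes "BES3 M X 1"
  shows "(\<integral>\<omega>. max (1 / X 0 \<omega> - K) 0 \<partial>M) = max (1 - K) 0"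
proof -
  have "prob_space M" and [measurable]: "X 0 \<in> borel_measurable M"
    using assms by (simp_all add: BES3_def)
  have "(\<integral>\<omega>. max (1 / X 0 \<omega> - K) 0 \<partial>M) = (\<integral>\<omega>. max (1 - K) 0 \<partial>M)"
    by (rule integral_cong_AE) (use BES3_start[OF assms] in \<open>auto elim!: eventually_mono\<close>)
  also have "\<dots> = max (1 - K) 0"
    using prob_space.prob_space[OF \<open>prob_space M\<close>] by simp
  finally show ?thesis .
qed

text \<open>The neighborhood of zero is taken as \<open>{0..<\<epsilon>}\<close>, so that it
  includes time 0.\<close>

theorem proposition8:
  fixes M :: "'w measure" and X :: "real \<Rightarrow> 'w \<Rightarrow> real"
  assumes "BES3 M X 1"
  shows "(\<forall>K::real. 0 \<le> K \<and> K \<le> 1/2 \<longrightarrow>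
            strict_antimono_on {0<..} (\<lambda>t. \<integral>\<omega>. max (1 / X t \<omega> - K) 0 \<partial>M)) \<and>
         (\<forall>K::real. K > 1/2 \<longrightarrow>
            (\<exists>\<epsilon>>0. strict_mono_on {0..<\<epsilon>} (\<lambda>t. \<integral>\<omega>. max (1 / X t \<omega> - K) 0 \<partial>M)) \<and>
            (\<exists>T. strict_antimono_on {T..} (\<lambda>t. \<integral>\<omega>. max (1 / X t \<omega> - K) 0 \<partial>M)) \<and>
            strict_antimono_on {inverse (K * ln ((2 * K + 1) / (2 * K - 1)))..}
              (\<lambda>t. \<integral>\<omega>. max (1 / X t \<omega> - K) 0 \<partial>M))"
proof (intro conjI allI impI)
  let ?V = "\<lambda>K t. \<integral>\<omega>. max (1 / X t \<omega> - K) 0 \<partial>M"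
  note V = BES3_call[OF assms]
  have antimono_V: "strict_antimono_on S (?V K)"
    if "K > 0" "S \<subseteq> {0<..}" "is_interval S" "\<And>t. t \<in> S \<Longrightarrow> drift_ratio K (1 / t) < 1 / t" for K S
    using call_value_strict_antimono[OF that] that(1,2) V
    unfolding monotone_on_def by (metis greaterThan_iff subsetD)
  fix K :: real
  show "strict_antimono_on {0<..} (?V K)" if K: "0 \<le> K \<and> K \<le> 1 / 2"
  \<comment> \<open>Strike 0 has its own closed form, decreasing because \<open>1 / sqrt t\<close>
    is.\<close>
  proof (cases "K = 0")
    case True
    have "?V 0 t < ?V 0 s" if "0 < s" "s < t" for s t
    proof -
      have "1 / sqrt t < 1 / sqrt s"
        using that by (intro divide_strict_left_mono) auto
      then show ?thesis
        using that BES3_call_strike_0[OF assms, of s] BES3_call_strike_0[OF assms, of t]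
          std_normal_cdf_strict_mono[of "1 / sqrt t" "1 / sqrt s"] by linarith
    qed
    then show ?thesis
      unfolding True by (intro monotone_onI) simp
  next
    case False
    then show ?thesis
      using K drift_ratio_less_small_strike[of K] by (intro antimono_V) (auto simp: is_interval_oi)
  qed
  assume K: "K > 1 / 2"
  let ?u = "K * ln ((2 * K + 1) / (2 * K - 1))"
  have u: "?u > 0"
    using K by (intro mult_pos_pos ln_gt_zero) (auto simp: field_simps)
  \<comment> \<open>The threshold is positive, so the closed form is valid on the whole ray.\<close>
  have pos: "t > 0" if "t \<in> {inverse ?u..}" for t
    using positive_imp_inverse_positive[OF u] that by (meson atLeast_iff less_le_trans)
  show late: "strict_antimono_on {inverse ?u..} (?V K)"
  proof (rule antimono_V)
    show "drift_ratio K (1 / t) < 1 / t" if "t \<in> {inverse ?u..}" for t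
    proof (rule drift_ratio_less[OF K])
      have "t \<ge> inverse ?u" "t > 0"
        using that pos by auto
      then show "0 < 1 / t" "1 / t \<le> ?u"
        using u le_imp_inverse_le[of "inverse ?u" t] by (auto simp: inverse_eq_divide)
    qed
  qed (use K pos in auto)
  then show "\<exists>T. strict_antimono_on {T..} (?V K)" by blast
  obtain \<epsilon> where \<epsilon>: "\<epsilon> > 0" "strict_mono_on {0<..<\<epsilon>} (call_value K)"
      "\<And>t. t \<in> {0<..<\<epsilon>} \<Longrightarrow> max (1 - K) 0 < call_value K t"
    using call_value_strict_mono_near_0[OF K] by blast
  have "strict_mono_on {0..<\<epsilon>} (?V K)"
  proof (rule monotone_onI)
    fix s t assume st: "s \<in> {0..<\<epsilon>}" "t \<in> {0..<\<epsilon>}" "s < t"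
    then have t: "?V K t = call_value K t"
      using V[of t K] K by simp
    show "?V K s < ?V K t"
    \<comment> \<open>At time 0 the expectation is \<open>max (1 - K) 0\<close>, computed from the
      starting value and not from \<open>call_value\<close>.\<close>
    proof (cases "s = 0")
      case True
      then show ?thesis
        unfolding t using \<epsilon>(3) st BES3_call_at_0[OF assms] by simp
    next
      case False
      then have "?V K s = call_value K s"
        using V[of s K] K st by simp
      then show ?thesis
        unfolding t using monotone_onD[OF \<epsilon>(2)] st False by simp
    qed
  qed
  with \<epsilon>(1) show "\<exists>\<epsilon>>0. strict_mono_on {0..<\<epsilon>} (?V K)" by blast
qed

end
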